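(* Let $N\ge1$ be an integer and $\lambda>0$, with associated $\delta$, $a_\delta$, $q$, $D_\delta$ and one-step kernel $H$. For every finite disjoint union $A$ of arcs of $\mathbb{T}_1$, $$0\le H(A)-q^2|A|^2\le\frac{2a_\delta^2}{\pi}|A|.$$ The lower bound $0\le H(A)-q^2|A|^2$ is an equality only when the circular convolution $D_\delta*\mathbf{1}_A$ is constant. In particular, the deterministic contraction $H(A)\le q^2|A|^2$ fails in general; for instance it fails for every sufficiently short arc, i.e. there is $L_0>0$ (depending on $\delta$) such that $H(A)>q^2|A|^2$ for every arc $A$ with $0<|A|<L_0$.
   Context: Parameters. For an integer $N\ge1$ and real $\lambda>0$ put $\delta=1-\frac{2}{e^{\lambda/N}+1}\in(0,1)$, $a_\delta=2\arctan\frac{\delta}{\sqrt{1-\delta^2}}$, $q=1-\frac{a_\delta}{\pi}\in(0,1)$. Let $\mathbb{T}_1=\mathbb{R}/(2\pi\mathbb{Z})$ and let $|\cdot|$ be Lebesgue length on $\mathbb{T}_1$. Inverse slit map. Let $D_\delta(u)=\sqrt{1-\delta^2}\,\frac{|\tan(u/2)|}{\sqrt{\tan^2(u/2)+\delta^2}}$ for $u\in\mathbb{T}_1\setminus\{0\}$ (with value $\sqrt{1-\delta^2}$ at $u=\pi$ by continuity), $D_\delta(0)=0$. For $x\in\mathbb{T}_1$ and $s\in(0,2\pi)$ set $S^{\mathtt{inv}}_x(x+s)=x+a_\delta+\int_0^{s}D_\delta(u)\,du$ (mod $2\pi$); this is an injective map from $\mathbb{T}_1\setminus\{x\}$ onto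 $\mathbb{T}_1\setminus[x-a_\delta,x+a_\delta]$, with derivative $D_\delta(\theta-x)$ at $\theta$. Zero-colored update. For a finite union $A$ of closed arcs of $\mathbb{T}_1$ (possibly $A=\mathbb{T}_1$), $\widehat S^{\,\mathtt{inv}}_x(A)$ is the closure of $S^{\mathtt{inv}}_x(A\setminus\{x\})$. That is, an arc $J$ of $A$ not containing $x$ is replaced by $S^{\mathtt{inv}}_x(J)$, and an arc $J=[a,b]$ containing $x$ is replaced by the two arcs $[S^{\mathtt{inv}}_x(a),x-a_\delta]$ and $[x+a_\delta,S^{\mathtt{inv}}_x(b)]$. One-step kernel. For a finite disjoint union $A$ of (closed) arcs, let $F_A(x)=\bigl|\widehat S^{\,\mathtt{inv}}_x(A)\bigr|$ for $x\in\mathbb{T}_1$, and $$H(A)=\frac{1}{2\pi}\int_{\mathbb{T}_1}F_A(x)^2\,dx.$$ Convolution: $(D_\delta*\mathbf{1}_A)(x)=\int_{\mathbb{T}_1}D_\delta(x-y)\mathbf{1}_A(y)\,dy$. *)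

theory Defs
  imports "HOL-Analysis.Analysis"
begin

text \<open>The circle \<open>\<real>/(2\<pi>\<int>)\<close>; \<open>mod2pi\<close> is the quotient map.\<close>

definition eq_mod2pi :: "real \<Rightarrow> real \<Rightarrow> bool" where
  "eq_mod2pi s t \<longleftrightarrow> (\<exists>k::int. s - t = 2 * pi * of_int k)"

lemma equivp_eq_mod2pi: "equivp eq_mod2pi"
proof (rule equivpI)
  show "reflp eq_mod2pi"
    by (rule reflpI) (auto simp: eq_mod2pi_def intro: exI[of _ 0])
  show "symp eq_mod2pi"
  proof (rule sympI)
    fix s t assume "eq_mod2pi s t"
    then obtain k :: int where "s - t = 2 * pi * of_int k" by (auto simp: eq_mod2pi_def)
    then have "t - s = 2 * pi * of_int (- k)" by simp
    then show "eq_mod2pi t s" unfolding eq_mod2pi_def by blast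
  qed
  show "transp eq_mod2pi"
  proof (rule transpI)
    fix r s t assume "eq_mod2pi r s" "eq_mod2pi s t"
    then obtain k l :: int where "r - s = 2 * pi * of_int k" "s - t = 2 * pi * of_int l"
      by (auto simp: eq_mod2pi_def)
    then have "r - t = 2 * pi * of_int (k + l)" by (simp add: algebra_simps)
    then show "eq_mod2pi r t" unfolding eq_mod2pi_def by blast
  qed
qed

quotient_type circle = real / eq_mod2pi
  morphisms rep_circle mod2pi
  by (rule equivp_eq_mod2pi)

instantiation circle :: ab_group_add
begin

lift_definition zero_circle :: circle is "0 :: real" .

lift_definition plus_circle :: "circle \<Rightarrow> circle \<Rightarrow> circle" is "(+)"
proof -
  fix a b c d assume "eq_mod2pi a b" "eq_mod2pi c d"
  then obtain k l :: int where "a - b = 2 * pi * of_int k" "c - d = 2 * pi * of_int l"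
    by (auto simp: eq_mod2pi_def)
  then have "(a + c) - (b + d) = 2 * pi * of_int (k + l)" by (simp add: algebra_simps)
  then show "eq_mod2pi (a + c) (b + d)" unfolding eq_mod2pi_def by blast
qed

lift_definition uminus_circle :: "circle \<Rightarrow> circle" is uminus
proof -
  fix a b assume "eq_mod2pi a b"
  then obtain k :: int where "a - b = 2 * pi * of_int k"
    by (auto simp: eq_mod2pi_def)
  then have "(- a) - (- b) = 2 * pi * of_int (- k)" by simp
  then show "eq_mod2pi (- a) (- b)" unfolding eq_mod2pi_def by blast
qed

definition minus_circle :: "circle \<Rightarrow> circle \<Rightarrow> circle" where
  "minus_circle x y = x + (- y)"

instance
proof
  fix x y z :: circle
  show "x + y + z = x + (y + z)"
    by transfer (simp add: add.assoc equivp_reflp[OF equivp_eq_mod2pi])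
  show "x + y = y + x"
    by transfer (simp add: add.commute equivp_reflp[OF equivp_eq_mod2pi])
  show "0 + x = x"
    by transfer (simp add: equivp_reflp[OF equivp_eq_mod2pi])
  show "- x + x = 0"
    by transfer (simp add: equivp_reflp[OF equivp_eq_mod2pi])
  show "x - y = x + - y"
    by (simp add: minus_circle_def)
qed

end

text \<open>The quotient topology.\<close>

instantiation circle :: topological_space
begin

definition open_circle :: "circle set \<Rightarrow> bool" where
  "open_circle U \<longleftrightarrow> open (mod2pi -` U)"

instance
  by standard (auto simp: open_circle_def vimage_Int vimage_Union)

end

lemma continuous_on_mod2pi: "continuous_on UNIV mod2pi"
  by (auto simp: continuous_on_open_vimage open_circle_def)

text \<open>Lebesgue (arc length) measure on the circle, of total mass \<open>2\<pi>\<close>.\<close>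

definition circle_measure :: "circle measure" where
  "circle_measure = distr (restrict_space lborel {0..<2 * pi}) borel mod2pi"

lemma measurable_mod2pi: "mod2pi \<in> measurable (restrict_space lborel {0..<2 * pi}) borel"
proof -
  have "mod2pi \<in> borel_measurable borel"
    by (rule borel_measurable_continuous_onI[OF continuous_on_mod2pi])
  then show ?thesis
    by (intro measurable_restrict_space1) simp
qed

definition len :: "circle set \<Rightarrow> real" where
  "len A = measure circle_measure A"

definition angle :: "circle \<Rightarrow> real" where
  "angle u = (THE s. 0 \<le> s \<and> s < 2 * pi \<and> mod2pi s = u)"

lemma ex1_angle: "\<exists>!s. 0 \<le> s \<and> s < 2 * pi \<and> mod2pi s = u"
proof (rule ex_ex1I)
  obtain t where t: "mod2pi t = u"
    by (metis Quotient_abs_rep[OF Quotient_circle])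
  define k where "k = \<lfloor>t / (2 * pi)\<rfloor>"
  have "of_int k \<le> t / (2 * pi)" "t / (2 * pi) < of_int k + 1"
    unfolding k_def by linarith+
  then have "2 * pi * of_int k \<le> t" "t < 2 * pi * of_int k + 2 * pi"
    by (simp_all add: field_simps)
  moreover have "mod2pi (t - 2 * pi * of_int k) = mod2pi t"
    unfolding circle.abs_eq_iff eq_mod2pi_def
    by (rule exI[of _ "- k"]) simp
  ultimately show "\<exists>s. 0 \<le> s \<and> s < 2 * pi \<and> mod2pi s = u"
    using t by (intro exI[of _ "t - 2 * pi * of_int k"]) auto
next
  fix s t assume s: "0 \<le> s \<and> s < 2 * pi \<and> mod2pi s = u"
    and t: "0 \<le> t \<and> t < 2 * pi \<and> mod2pi t = u"
  then have "mod2pi s = mod2pi t" by simp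
  then obtain k :: int where k: "s - t = 2 * pi * of_int k"
    unfolding circle.abs_eq_iff eq_mod2pi_def by blast
  have "2 * pi * of_int k < 2 * pi * 1" "2 * pi * (- 1) < 2 * pi * of_int k"
    using k s t by linarith+
  then have "of_int k < (1::real)" "(- 1::real) < of_int k"
    by (simp_all only: mult_less_cancel_left_pos[of "2 * pi"] pi_gt_zero mult_pos_pos zero_less_numeral)
  then have "k = 0" by linarith
  then show "s = t" using k by simp
qed

definition slit_delta :: "nat \<Rightarrow> real \<Rightarrow> real" where
  "slit_delta N l = 1 - 2 / (exp (l / real N) + 1)"

definition slit_a :: "real \<Rightarrow> real" where
  "slit_a \<delta> = 2 * arctan (\<delta> / sqrt (1 - \<delta>\<^sup>2))"

definition slit_q :: "real \<Rightarrow> real" where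
  "slit_q \<delta> = 1 - slit_a \<delta> / pi"

text \<open>The value at \<open>\<pi>\<close> is given separately because \<open>tan (pi / 2) = 0\<close> in HOL.\<close>

definition slit_D :: "real \<Rightarrow> circle \<Rightarrow> real" where
  "slit_D \<delta> u =
    (if u = 0 then 0
     else if u = mod2pi pi then sqrt (1 - \<delta>\<^sup>2)
     else sqrt (1 - \<delta>\<^sup>2) * (\<bar>tan (angle u / 2)\<bar> / sqrt ((tan (angle u / 2))\<^sup>2 + \<delta>\<^sup>2)))"

text \<open>Meaningful for \<open>y \<noteq> x\<close> only; then \<open>angle (y - x)\<close> is the \<open>s \<in> (0, 2\<pi>)\<close> with \<open>y = x + s\<close>.\<close>

definition slit_inv :: "real \<Rightarrow> circle \<Rightarrow> circle \<Rightarrow> circle" where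
  "slit_inv \<delta> x y =
    x + mod2pi (slit_a \<delta> + integral {0..angle (y - x)} (\<lambda>u. slit_D \<delta> (mod2pi u)))"

definition slit_update :: "real \<Rightarrow> circle \<Rightarrow> circle set \<Rightarrow> circle set" where
  "slit_update \<delta> x A = closure (slit_inv \<delta> x ` (A - {x}))"

text \<open>Closed arcs; single points and the whole circle are included.\<close>

definition is_arc :: "circle set \<Rightarrow> bool" where
  "is_arc J \<longleftrightarrow> (\<exists>a b. a \<le> b \<and> b \<le> a + 2 * pi \<and> J = mod2pi ` {a..b})"

definition disjoint_arc_union :: "circle set \<Rightarrow> bool" where
  "disjoint_arc_union A \<longleftrightarrow>
    (\<exists>\<J>. finite \<J> \<and> (\<forall>J\<in>\<J>. is_arc J) \<and> disjoint \<J> \<and> A = \<Union>\<J>)"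

definition slit_F :: "real \<Rightarrow> circle set \<Rightarrow> circle \<Rightarrow> real" where
  "slit_F \<delta> A x = len (slit_update \<delta> x A)"

definition slit_H :: "real \<Rightarrow> circle set \<Rightarrow> real" where
  "slit_H \<delta> A = 1 / (2 * pi) * (LINT x|circle_measure. (slit_F \<delta> A x)\<^sup>2)"

definition circle_conv :: "(circle \<Rightarrow> real) \<Rightarrow> (circle \<Rightarrow> real) \<Rightarrow> circle \<Rightarrow> real" where
  "circle_conv f g x = (LINT y|circle_measure. f (x - y) * g y)"

end

(*
  The derivative of the inverse slit map is D, so F_A = D * 1_A, and its mean over the circle is
  q |A| because D has integral 2 pi - 2 a.  Hence H(A) - q^2 |A|^2 is the variance of F_A: it is
  nonnegative, and by continuity it vanishes only if D * 1_A is constant.  For the upper bound, the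
  variance of F_A is that of |A| - F_A = (1 - D) * 1_A, which takes values in [0, 2 a] and has
  integral 2 a |A|.  For a short arc, D(0) = 0 makes F_A smaller than its mean q |A| at an endpoint.
*)
theory Submission imports Defs begin

subsection \<open>Arc length on the circle\<close>

text \<open>The obstacle is that \<open>slit_update\<close> is the closure of an image under a map
  given by the integral of a tangent expression. With
  \<open>c = sqrt (1 - \<delta>\<^sup>2)\<close>, clearing the tangent turns D into \<open>c *
  \<bar>sin (s / 2)\<bar> / sqrt (1 - (c * cos (s / 2))\<^sup>2)\<close>, which on the interval from
  0 to 2 pi is the derivative of \<open>2 * arccos (c * cos (s / 2))\<close>. The inverse slit map
  thus has an explicit lift, strictly increasing from a to 2 pi - a, and the convolution formula for
  F_A becomes a one-dimensional change of variables in the coordinate measured from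
  \<open>x\<close>. That coordinate interval is taken closed, both ends standing for
  \<open>x\<close>: the lifted image of a closed set is then compact, and it exceeds the image of
  \<open>A - {x}\<close> by at most the two tips of the slit.\<close>

lemma mod2pi_add: "mod2pi (s + t) = mod2pi s + mod2pi t"
  by (simp add: plus_circle.abs_eq)

lemma mod2pi_uminus: "mod2pi (- s) = - mod2pi s"
  by (simp add: uminus_circle.abs_eq)

lemma mod2pi_diff: "mod2pi (s - t) = mod2pi s - mod2pi t"
  using mod2pi_add[of s "- t"] by (simp add: mod2pi_uminus)

lemma mod2pi_eq_iff: "mod2pi s = mod2pi t \<longleftrightarrow> (\<exists>k::int. s = t + 2 * pi * of_int k)"
  unfolding circle.abs_eq_iff eq_mod2pi_def by (metis add.commute diff_eq_eq)

lemma mod2pi_periodic [simp]: "mod2pi (s + 2 * pi) = mod2pi s" "mod2pi (s - 2 * pi) = mod2pi s"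
  by (auto simp: mod2pi_eq_iff intro: exI[of _ 1] exI[of _ "-1"])

lemma angle_nonneg: "0 \<le> angle u" and angle_less: "angle u < 2 * pi"
  and mod2pi_angle [simp]: "mod2pi (angle u) = u"
  using theI'[OF ex1_angle[of u]] unfolding angle_def by auto

lemma angle_mod2pi: "0 \<le> s \<Longrightarrow> s < 2 * pi \<Longrightarrow> angle (mod2pi s) = s"
  using ex1_angle[of "mod2pi s"] angle_nonneg angle_less mod2pi_angle by blast

lemma circle_cases: obtains s where "0 \<le> s" "s < 2 * pi" "u = mod2pi s"
  using that[of "angle u"] angle_nonneg angle_less by simp

lemma mod2pi_eq_imp_eq:
  "mod2pi s = mod2pi t \<Longrightarrow> 0 \<le> s \<Longrightarrow> s < 2 * pi \<Longrightarrow> 0 \<le> t \<Longrightarrow> t < 2 * pi \<Longrightarrow> s = t"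
  by (metis angle_mod2pi)

lemma continuous_on_circleI:
  fixes f :: "circle \<Rightarrow> 'a::topological_space"
  assumes "continuous_on UNIV (\<lambda>s. f (mod2pi s))"
  shows "continuous_on UNIV f"
  using assms
  by (auto simp: continuous_on_open_vimage open_circle_def vimage_def)

text \<open>The full preimage is the sum of the compact set \<open>K\<close> and the closed lattice
  of multiples of \<open>2 * pi\<close>, and such a sum is closed.\<close>

lemma closed_mod2pi_image:
  assumes "compact K"
  shows "closed (mod2pi ` K)"
proof -
  have "mod2pi s \<in> mod2pi ` K \<longleftrightarrow> (\<exists>x\<in>K. \<exists>k. s = x + 2 * pi * of_int k)" for s
    by (auto simp: image_iff mod2pi_eq_iff)
  then have eq: "mod2pi -` (mod2pi ` K) = (\<Union>x\<in>K. \<Union>y\<in>(*) (2 * pi) ` \<int>. {x + y})"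
    by (simp add: set_eq_iff Ints_def)
  have scale: "(*\<^sub>R) (2 * pi) = ((*) (2 * pi) :: real \<Rightarrow> real)"
    by (simp add: fun_eq_iff)
  have "closed ((*) (2 * pi) ` (\<int> :: real set))"
    using closed_scaling[OF closed_Ints[where 'a = real], of "2 * pi"] unfolding scale .
  then have "closed (mod2pi -` (mod2pi ` K))"
    unfolding eq by (intro compact_closed_sums assms)
  then show ?thesis
    by (simp add: closed_def open_circle_def vimage_Compl)
qed

lemma continuous_on_circle_add: "continuous_on UNIV ((+) (x :: circle))"
proof (rule continuous_on_circleI)
  have "continuous_on UNIV (\<lambda>s. mod2pi (angle x + s))"
    by (intro continuous_on_compose2[OF continuous_on_mod2pi] continuous_intros) auto
  then show "continuous_on UNIV (\<lambda>s. x + mod2pi s)"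
    by (simp add: mod2pi_add)
qed

lemma measurable_circle_add [measurable]: "(+) (x :: circle) \<in> borel_measurable borel"
  by (rule borel_measurable_continuous_onI[OF continuous_on_circle_add])

lemma borel_measurable_mod2pi [measurable]: "mod2pi \<in> borel_measurable borel"
  by (rule borel_measurable_continuous_onI[OF continuous_on_mod2pi])

lemma closed_circle_add:
  assumes "closed (B :: circle set)"
  shows "closed ((+) x ` B)"
proof -
  have "(+) x ` B = (+) (- x) -` B"
  proof (intro set_eqI iffI)
    fix y assume "y \<in> (+) (- x) -` B"
    then show "y \<in> (+) x ` B"
      by (intro image_eqI[of _ _ "- x + y"]) auto
  qed auto
  then show ?thesis
    using continuous_on_closed_vimage[of UNIV "(+) (- x)"] continuous_on_circle_add[of "- x"] assms
    by simp
qed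

section \<open>Lebesgue measure on the circle and its invariance under rotations\<close>

lemma sets_circle_measure [simp, measurable_cong]: "sets circle_measure = sets borel"
  and space_circle_measure [simp]: "space circle_measure = UNIV"
  by (simp_all add: circle_measure_def)

lemma emeasure_circle_measure:
  "B \<in> sets borel \<Longrightarrow> emeasure circle_measure B = emeasure lborel (mod2pi -` B \<inter> {0..<2 * pi})"
  unfolding circle_measure_def
  by (subst emeasure_distr[OF measurable_mod2pi])
    (auto simp: space_restrict_space intro!: emeasure_restrict_space)

lemma len_eq_measure_lborel:
  "B \<in> sets borel \<Longrightarrow> len B = measure lborel (mod2pi -` B \<inter> {0..<2 * pi})"
  unfolding len_def measure_def by (simp add: emeasure_circle_measure)

lemma emeasure_circle_UNIV: "emeasure circle_measure UNIV = ennreal (2 * pi)"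
  by (simp add: emeasure_circle_measure)

interpretation circle: finite_measure circle_measure
  by standard (simp add: emeasure_circle_UNIV)

lemma measure_circle_UNIV: "measure circle_measure UNIV = 2 * pi"
  by (simp add: measure_def emeasure_circle_UNIV)

lemma integral_circle_measure:
  fixes f :: "circle \<Rightarrow> real"
  assumes [measurable]: "f \<in> borel_measurable borel"
  shows "(LINT x|circle_measure. f x) = (LINT s|restrict_space lborel {0..<2 * pi}. f (mod2pi s))"
  unfolding circle_measure_def by (intro integral_distr measurable_mod2pi assms)

lemma emeasure_lborel_vimage_add:
  "B \<in> sets borel \<Longrightarrow> emeasure lborel ((+) c -` B) = emeasure lborel (B :: real set)"
  using emeasure_distr[of "(+) c" lborel borel B] by (simp add: lborel_distr_plus)

text \<open>Read on \<open>{0..<2 * pi}\<close>, the rotation by \<open>t\<close> exchanges two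
  intervals: points below \<open>2 * pi - t\<close> move by \<open>t\<close>, the others by
  \<open>t - 2 * pi\<close>. Each piece is a translation, which preserves
  \<open>lborel\<close>.\<close>

lemma circle_measure_translation: "distr circle_measure borel ((+) x) = circle_measure"
proof (rule measure_eqI)
  fix B assume "B \<in> sets (distr circle_measure borel ((+) x))"
  then have B [measurable]: "B \<in> sets borel" by simp
  define P where "P = mod2pi -` B"
  have [measurable]: "P \<in> sets borel"
    unfolding P_def using measurable_sets[OF borel_measurable_mod2pi B] by simp
  define t where "t = angle x"
  have t: "0 \<le> t" "t < 2 * pi" "x = mod2pi t"
    by (simp_all add: t_def angle_nonneg angle_less)
  have Bx: "(+) x -` B \<in> sets borel"
    using measurable_sets[OF measurable_circle_add B] by simp
  have eq: "mod2pi -` ((+) x -` B) \<inter> {0..<2 * pi} =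
      (+) t -` (P \<inter> {t..<2 * pi}) \<union> (+) (t - 2 * pi) -` (P \<inter> {0..<t})"
    using t by (auto simp: P_def mod2pi_add)
  have "emeasure (distr circle_measure borel ((+) x)) B =
      emeasure lborel (mod2pi -` ((+) x -` B) \<inter> {0..<2 * pi})"
    using Bx by (simp add: emeasure_distr emeasure_circle_measure)
  also have "\<dots> = emeasure lborel ((+) t -` (P \<inter> {t..<2 * pi})) +
      emeasure lborel ((+) (t - 2 * pi) -` (P \<inter> {0..<t}))"
    unfolding eq
  proof (rule plus_emeasure[symmetric])
    show "(+) t -` (P \<inter> {t..<2 * pi}) \<in> sets lborel"
      using measurable_sets[of "(+) t" borel borel "P \<inter> {t..<2 * pi}"] by simp
    show "(+) (t - 2 * pi) -` (P \<inter> {0..<t}) \<in> sets lborel"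
      using measurable_sets[of "(+) (t - 2 * pi)" borel borel "P \<inter> {0..<t}"] by simp
  qed (use t in auto)
  also have "\<dots> = emeasure lborel (P \<inter> {t..<2 * pi}) + emeasure lborel (P \<inter> {0..<t})"
    by (simp only: emeasure_lborel_vimage_add[OF sets.Int] \<open>P \<in> sets borel\<close> atLeastLessThan_borel)
  also have "\<dots> = emeasure lborel (P \<inter> {t..<2 * pi} \<union> P \<inter> {0..<t})"
    by (intro plus_emeasure) auto
  also have "P \<inter> {t..<2 * pi} \<union> P \<inter> {0..<t} = P \<inter> {0..<2 * pi}"
    using t by auto
  finally show "emeasure (distr circle_measure borel ((+) x)) B = emeasure circle_measure B"
    by (simp add: P_def emeasure_circle_measure)
qed simp

lemma integral_circle_add:
  fixes f :: "circle \<Rightarrow> real"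
  assumes [measurable]: "f \<in> borel_measurable borel"
  shows "(LINT y|circle_measure. f (x + y)) = (LINT y|circle_measure. f y)"
proof -
  have "(LINT y|circle_measure. f y) = (LINT y|distr circle_measure borel ((+) x). f y)"
    by (simp add: circle_measure_translation)
  also have "\<dots> = (LINT y|circle_measure. f (x + y))"
    by (intro integral_distr) measurable
  finally show ?thesis by simp
qed

lemma len_circle_add:
  assumes [measurable]: "(+) x ` B \<in> sets borel"
  shows "len ((+) x ` B) = len B"
proof -
  have "(+) x -` ((+) x ` B) = B"
    by auto
  then have "measure (distr circle_measure borel ((+) x)) ((+) x ` B) = len B"
    by (simp add: measure_distr len_def)
  then show ?thesis
    by (simp add: circle_measure_translation len_def)
qed

lemma len_mod2pi_Icc:
  assumes "a \<le> b" "b \<le> a + 2 * pi"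
  shows "len (mod2pi ` {a..b}) = b - a"
proof -
  have "mod2pi ` {a..b} = (\<lambda>s. mod2pi (a + s)) ` {0..b - a}"
    unfolding image_image[of mod2pi "(+) a", symmetric] by (simp add: image_add_atLeastAtMost)
  then have eq: "mod2pi ` {a..b} = (+) (mod2pi a) ` mod2pi ` {0..b - a}"
    by (simp add: image_image mod2pi_add)
  have cl: "closed (mod2pi ` {0..b - a})" "closed (mod2pi ` {a..b})"
    by (auto intro: closed_mod2pi_image)
  have "mod2pi -` (mod2pi ` {0..b - a}) \<inter> {0..<2 * pi} = {0..b - a} \<inter> {0..<2 * pi}" (is "?L = ?R")
  proof
    show "?L \<subseteq> ?R"
    proof
      fix s assume "s \<in> ?L"
      then obtain r where r: "mod2pi s = mod2pi r" "0 \<le> r" "r \<le> b - a" and s: "0 \<le> s" "s < 2 * pi"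
        by auto
      show "s \<in> ?R"
      proof (cases "r = 2 * pi")
        \<comment> \<open>Here \<open>b - a = 2 * pi\<close>, so the right-hand side is all of
          \<open>{0..<2 * pi}\<close>.\<close>
        case True
        then show ?thesis using r s assms by auto
      next
        case False
        then have "s = r" using r s assms by (intro mod2pi_eq_imp_eq) auto
        then show ?thesis using r s by auto
      qed
    qed
  qed auto
  moreover have "len (mod2pi ` {a..b}) = len (mod2pi ` {0..b - a})"
    unfolding eq by (rule len_circle_add) (use cl(2) eq in auto)
  ultimately have "len (mod2pi ` {a..b}) = measure lborel ({0..b - a} \<inter> {0..<2 * pi})"
    using cl by (simp add: len_eq_measure_lborel)
  also have "{0..b - a} \<inter> {0..<2 * pi} = (if b - a < 2 * pi then {0..b - a} else {0..<2 * pi})"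
    using assms by auto
  finally show ?thesis using assms by (auto split: if_splits)
qed

lemma closed_arc: "is_arc J \<Longrightarrow> closed J"
  unfolding is_arc_def by (auto intro: closed_mod2pi_image)

lemma closed_disjoint_arc_union: "disjoint_arc_union A \<Longrightarrow> closed A"
  unfolding disjoint_arc_union_def by (auto intro: closed_arc)

lemma closed_circle_singleton [simp]: "closed {u :: circle}"
  using closed_mod2pi_image[of "{angle u}"] by simp

lemma closed_circle_insert: "closed B \<Longrightarrow> closed (insert (u :: circle) B)"
  using closed_Un[OF closed_circle_singleton, of B u] by simp

text \<open>Single points are null. This disposes of the tips that the closure in
  \<open>slit_update\<close> may add.\<close>

lemma len_insert:
  assumes "closed B"
  shows "len (insert u B) = len B"
proof -
  have "mod2pi -` {u} \<inter> {0..<2 * pi} = {angle u}"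
    using angle_nonneg[of u] angle_less[of u] by (auto simp: angle_mod2pi)
  then have "len {u} = 0"
    by (simp add: len_eq_measure_lborel)
  moreover have "len ({u} \<union> B) \<le> len {u} + len B"
    unfolding len_def using assms by (intro measure_Un_le) auto
  moreover have "len B \<le> len ({u} \<union> B)"
    unfolding len_def using closed_circle_insert[OF assms, of u]
    by (intro circle.finite_measure_mono) auto
  ultimately show ?thesis by simp
qed

text \<open>The null endpoint \<open>2 * pi\<close> is added because the substitution rule and the
  fundamental theorem of calculus are applied on closed intervals.\<close>

lemma integral_circle_measure_Icc:
  fixes f :: "circle \<Rightarrow> real"
  assumes [measurable]: "f \<in> borel_measurable borel"
  shows "(LINT x|circle_measure. f x) = (LINT s|lborel. f (mod2pi s) * indicator {0..2 * pi} s)"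
proof -
  have "(LINT x|circle_measure. f x) = (LINT s|lborel. indicator {0..<2 * pi} s *\<^sub>R f (mod2pi s))"
    unfolding integral_circle_measure[OF assms] by (rule integral_restrict_space) auto
  also have "\<dots> = (LINT s|lborel. f (mod2pi s) * indicator {0..2 * pi} s)"
    by (intro integral_cong_AE) (use AE_lborel_singleton[of "2 * pi"] in \<open>auto elim!: eventually_mono split: split_indicator\<close>)
  finally show ?thesis .
qed

subsection \<open>The inverse slit map\<close>

text \<open>\<open>slit_dens\<close> is \<open>slit_D\<close> with the tangent cleared, hence continuous on all of \<open>\<real>\<close> also at \<open>\<pi>\<close>;
  \<open>slit_prim \<delta>\<close> is the lift \<open>s \<mapsto> a + (integral of D over [0, s])\<close> of the inverse slit map on \<open>[0, 2\<pi>]\<close>.\<close>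

definition slit_dens :: "real \<Rightarrow> real \<Rightarrow> real" where
  "slit_dens \<delta> s = sqrt (1 - \<delta>\<^sup>2) * \<bar>sin (s / 2)\<bar> / sqrt (1 - (sqrt (1 - \<delta>\<^sup>2) * cos (s / 2))\<^sup>2)"

definition slit_prim :: "real \<Rightarrow> real \<Rightarrow> real" where
  "slit_prim \<delta> s = 2 * arccos (sqrt (1 - \<delta>\<^sup>2) * cos (s / 2))"

lemma slit_delta_bounds:
  assumes "N \<ge> 1" "l > 0"
  shows "0 < slit_delta N l" "slit_delta N l < 1"
proof -
  have "exp (l / real N) > 1"
    using assms by simp
  then show "0 < slit_delta N l" "slit_delta N l < 1"
    by (simp_all add: slit_delta_def add_pos_pos)
qed

context
  fixes \<delta> :: real
  assumes \<delta>: "0 < \<delta>" "\<delta> < 1"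
begin

lemma delta_square: "0 < 1 - \<delta>\<^sup>2" "1 - \<delta>\<^sup>2 < 1"
  using \<delta> by (simp_all add: power_less_one_iff abs_square_less_1)

lemma sqrt_delta: "0 < sqrt (1 - \<delta>\<^sup>2)" "sqrt (1 - \<delta>\<^sup>2) < 1"
  using delta_square by simp_all

lemma scaled_cos_bounds: "- 1 < sqrt (1 - \<delta>\<^sup>2) * cos t" "sqrt (1 - \<delta>\<^sup>2) * cos t < 1"
proof -
  have "\<bar>sqrt (1 - \<delta>\<^sup>2) * cos t\<bar> \<le> sqrt (1 - \<delta>\<^sup>2) * 1"
    unfolding abs_mult using sqrt_delta by (intro mult_mono) auto
  then have "\<bar>sqrt (1 - \<delta>\<^sup>2) * cos t\<bar> < 1"
    using sqrt_delta by linarith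
  then show "- 1 < sqrt (1 - \<delta>\<^sup>2) * cos t" "sqrt (1 - \<delta>\<^sup>2) * cos t < 1"
    by linarith+
qed

lemma slit_dens_denom: "0 < 1 - (sqrt (1 - \<delta>\<^sup>2) * cos t)\<^sup>2"
  using scaled_cos_bounds[of t] by (simp add: abs_square_less_1 abs_less_iff)

text \<open>Divided by \<open>(cos t)\<^sup>2\<close>, the right-hand side is
  \<open>(tan t)\<^sup>2 + \<delta>\<^sup>2\<close>, the radicand in \<open>slit_D\<close>; this
  links the two formulas for the density.\<close>

lemma slit_dens_denom_eq: "1 - (sqrt (1 - \<delta>\<^sup>2) * cos t)\<^sup>2 = (sin t)\<^sup>2 + \<delta>\<^sup>2 * (cos t)\<^sup>2"
proof -
  have "(sqrt (1 - \<delta>\<^sup>2))\<^sup>2 = 1 - \<delta>\<^sup>2"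
    using delta_square by simp
  then show ?thesis
    unfolding power_mult_distrib sin_squared_eq by (simp only:) (simp add: algebra_simps)
qed

lemma continuous_on_slit_dens [continuous_intros]: "continuous_on S (slit_dens \<delta>)"
proof -
  have "sqrt (1 - (sqrt (1 - \<delta>\<^sup>2) * cos (s / 2))\<^sup>2) \<noteq> 0" for s
    using slit_dens_denom[of "s / 2"] by simp
  then show ?thesis
    unfolding slit_dens_def by (intro continuous_intros ballI) auto
qed

lemma slit_dens_nonneg: "0 \<le> slit_dens \<delta> s"
  unfolding slit_dens_def using sqrt_delta slit_dens_denom[of "s / 2"] by simp

text \<open>With \<open>c = sqrt (1 - \<delta>\<^sup>2)\<close>, the squared numerator and the term
  subtracted in the squared denominator add up to \<open>c\<^sup>2\<close>, which is below
  1.\<close>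

lemma slit_dens_le_1: "slit_dens \<delta> s \<le> 1"
proof -
  have "(sqrt (1 - \<delta>\<^sup>2) * \<bar>sin (s / 2)\<bar>)\<^sup>2 \<le> 1 - (sqrt (1 - \<delta>\<^sup>2) * cos (s / 2))\<^sup>2"
    using delta_square
    by (simp add: power_mult_distrib sin_squared_eq algebra_simps)
  then have "sqrt (1 - \<delta>\<^sup>2) * \<bar>sin (s / 2)\<bar> \<le> sqrt (1 - (sqrt (1 - \<delta>\<^sup>2) * cos (s / 2))\<^sup>2)"
    by (rule real_le_rsqrt)
  then show ?thesis
    unfolding slit_dens_def using slit_dens_denom[of "s / 2"] by (simp add: divide_le_eq_1)
qed

lemma slit_dens_even: "slit_dens \<delta> (- s) = slit_dens \<delta> s"
  by (simp add: slit_dens_def)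

text \<open>A full turn moves \<open>s / 2\<close> by \<open>pi\<close> only and flips the signs of
  sine and cosine; the density sees them through \<open>\<bar>sin\<bar>\<close> and the square of
  \<open>cos\<close>.\<close>

lemma slit_dens_periodic: "slit_dens \<delta> (s + 2 * pi * of_int k) = slit_dens \<delta> s"
proof -
  have eq: "(s + 2 * pi * of_int k) / 2 = s / 2 + pi * of_int k"
    by (simp add: field_simps)
  have "\<bar>sin (s / 2 + pi * of_int k)\<bar> = \<bar>sin (s / 2)\<bar>"
       "(cos (s / 2 + pi * of_int k))\<^sup>2 = (cos (s / 2))\<^sup>2"
    by (cases "even k"; simp add: sin_add cos_add)+
  then show ?thesis
    unfolding slit_dens_def eq by (simp add: power_mult_distrib)
qed

lemma slit_D_mod2pi: "slit_D \<delta> (mod2pi s) = slit_dens \<delta> s"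
proof -
  define r where "r = angle (mod2pi s)"
  have r: "0 \<le> r" "r < 2 * pi" "mod2pi s = mod2pi r"
    by (simp_all add: r_def angle_nonneg angle_less)
  obtain k :: int where "s = r + 2 * pi * of_int k"
    using r(3) mod2pi_eq_iff by blast
  then have s: "slit_dens \<delta> s = slit_dens \<delta> r"
    by (simp add: slit_dens_periodic)
  have r0: "mod2pi r = 0 \<longleftrightarrow> r = 0"
    using mod2pi_eq_imp_eq[of r 0] r by (auto simp: zero_circle_def)
  have rpi: "mod2pi r = mod2pi pi \<longleftrightarrow> r = pi"
    using mod2pi_eq_imp_eq[of r pi] r by auto
  consider "r = 0" | "r = pi" | "r \<noteq> 0" "r \<noteq> pi" by blast
  then have "slit_D \<delta> (mod2pi r) = slit_dens \<delta> r"
  proof cases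
    case 1
    then show ?thesis
      using r0 by (simp add: slit_D_def slit_dens_def)
  next
    case 2
    then show ?thesis
      using r0 rpi by (simp add: slit_D_def slit_dens_def)
  next
    case 3
    \<comment> \<open>Between 0 and \<open>pi\<close> the cosine vanishes only at
      \<open>pi / 2\<close>, so away from \<open>r = pi\<close> the tangent is a genuine
      quotient.\<close>
    have "0 < r / 2" "r / 2 < pi" "r / 2 \<noteq> pi / 2"
      using r 3 by auto
    then have cs: "cos (r / 2) \<noteq> 0"
      using arccos_cos[of "r / 2"] by auto
    have "(tan (r / 2))\<^sup>2 + \<delta>\<^sup>2 = (1 - (sqrt (1 - \<delta>\<^sup>2) * cos (r / 2))\<^sup>2) / (cos (r / 2))\<^sup>2"
      unfolding slit_dens_denom_eq using cs by (simp add: tan_def power_divide add_divide_distrib)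
    then have "sqrt ((tan (r / 2))\<^sup>2 + \<delta>\<^sup>2) =
        sqrt (1 - (sqrt (1 - \<delta>\<^sup>2) * cos (r / 2))\<^sup>2) / \<bar>cos (r / 2)\<bar>"
      by (simp add: real_sqrt_divide)
    then have "\<bar>tan (r / 2)\<bar> / sqrt ((tan (r / 2))\<^sup>2 + \<delta>\<^sup>2) =
        \<bar>sin (r / 2)\<bar> / sqrt (1 - (sqrt (1 - \<delta>\<^sup>2) * cos (r / 2))\<^sup>2)"
      using cs by (simp add: tan_def abs_divide)
    then show ?thesis
      using 3 by (simp add: slit_D_def r0 rpi angle_mod2pi r slit_dens_def)
  qed
  then show ?thesis
    using r s by simp
qed

lemma slit_D_minus: "slit_D \<delta> (- u) = slit_D \<delta> u"
  by (cases u rule: circle_cases) (simp add: mod2pi_uminus[symmetric] slit_D_mod2pi slit_dens_even)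

lemma slit_D_nonneg: "0 \<le> slit_D \<delta> u" and slit_D_le_1: "slit_D \<delta> u \<le> 1"
  by (cases u rule: circle_cases; simp add: slit_D_mod2pi slit_dens_nonneg slit_dens_le_1)+

lemma continuous_on_slit_D: "continuous_on UNIV (slit_D \<delta>)"
  by (rule continuous_on_circleI) (simp add: slit_D_mod2pi continuous_on_slit_dens)

lemma borel_measurable_slit_D [measurable]: "slit_D \<delta> \<in> borel_measurable borel"
  by (rule borel_measurable_continuous_onI[OF continuous_on_slit_D])

lemma borel_measurable_slit_dens [measurable]: "slit_dens \<delta> \<in> borel_measurable borel"
  by (rule borel_measurable_continuous_onI[OF continuous_on_slit_dens])

text \<open>The chain rule produces \<open>sin (s / 2)\<close> without absolute value; the range of
  \<open>s\<close> makes it nonnegative.\<close>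

lemma slit_prim_has_derivative:
  assumes "0 \<le> s" "s \<le> 2 * pi"
  shows "(slit_prim \<delta> has_real_derivative slit_dens \<delta> s) (at s)"
proof -
  have "((\<lambda>s. cos (s / 2)) has_real_derivative - sin (s / 2) * (1 / 2)) (at s)"
    by (rule DERIV_chain2[OF DERIV_cos]) (rule DERIV_cdivide[OF DERIV_ident])
  from DERIV_cmult[OF DERIV_chain2[OF DERIV_arccos[OF scaled_cos_bounds] DERIV_cmult[OF this]], of 2]
  have D: "(slit_prim \<delta> has_real_derivative
      2 * (inverse (- sqrt (1 - (sqrt (1 - \<delta>\<^sup>2) * cos (s / 2))\<^sup>2)) *
        (sqrt (1 - \<delta>\<^sup>2) * (- sin (s / 2) * (1 / 2))))) (at s)"
    by (simp only: slit_prim_def[abs_def])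
  have "\<bar>sin (s / 2)\<bar> = sin (s / 2)"
    using assms by (intro abs_of_nonneg sin_ge_zero) auto
  then have "2 * (inverse (- sqrt (1 - (sqrt (1 - \<delta>\<^sup>2) * cos (s / 2))\<^sup>2)) *
        (sqrt (1 - \<delta>\<^sup>2) * (- sin (s / 2) * (1 / 2)))) = slit_dens \<delta> s"
    by (simp only: slit_dens_def divide_inverse) simp
  with D show ?thesis
    by (simp only:)
qed

lemma slit_prim_strict_mono:
  assumes "0 \<le> s" "s < t" "t \<le> 2 * pi"
  shows "slit_prim \<delta> s < slit_prim \<delta> t"
proof -
  have "cos (t / 2) < cos (s / 2)"
    using assms by (intro cos_monotone_0_pi) auto
  then have "sqrt (1 - \<delta>\<^sup>2) * cos (t / 2) < sqrt (1 - \<delta>\<^sup>2) * cos (s / 2)"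
    using sqrt_delta(1) by (rule mult_strict_left_mono)
  then have "arccos (sqrt (1 - \<delta>\<^sup>2) * cos (s / 2)) < arccos (sqrt (1 - \<delta>\<^sup>2) * cos (t / 2))"
    using scaled_cos_bounds by (intro arccos_less_arccos less_imp_le)
  then show ?thesis
    unfolding slit_prim_def by simp
qed

lemma inj_on_slit_prim: "inj_on (slit_prim \<delta>) {0..2 * pi}"
proof (rule inj_onI)
  fix s t assume "s \<in> {0..2 * pi}" "t \<in> {0..2 * pi}" "slit_prim \<delta> s = slit_prim \<delta> t"
  then show "s = t"
    using slit_prim_strict_mono[of s t] slit_prim_strict_mono[of t s]
    by (cases s t rule: linorder_cases) auto
qed

text \<open>A right triangle with legs \<open>c = sqrt (1 - \<delta>\<^sup>2)\<close> and
  \<open>\<delta>\<close> has hypotenuse 1, so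
  \<open>arccos c = arctan (\<delta> / c)\<close>.\<close>

lemma slit_prim_0: "slit_prim \<delta> 0 = slit_a \<delta>"
proof -
  define c where "c = sqrt (1 - \<delta>\<^sup>2)"
  have c: "0 < c" "c\<^sup>2 = 1 - \<delta>\<^sup>2"
    using sqrt_delta delta_square by (simp_all add: c_def)
  have "1 + (\<delta> / c)\<^sup>2 = 1 / c\<^sup>2"
    using c by (simp add: power_divide field_simps)
  then have "cos (arctan (\<delta> / c)) = c"
    using c(1) by (simp only: cos_arctan) (simp add: real_sqrt_divide)
  moreover have "0 \<le> arctan (\<delta> / c)"
    using c \<delta> by (simp add: zero_le_arctan_iff)
  moreover have "arctan (\<delta> / c) \<le> pi"
    using arctan_ubound[of "\<delta> / c"] pi_gt_zero by linarith
  ultimately have "arccos c = arctan (\<delta> / c)"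
    by (metis arccos_cos)
  then show ?thesis
    by (simp add: slit_prim_def slit_a_def c_def)
qed

lemma slit_prim_2pi: "slit_prim \<delta> (2 * pi) = 2 * pi - slit_a \<delta>"
proof -
  have "arccos (- sqrt (1 - \<delta>\<^sup>2)) = pi - arccos (sqrt (1 - \<delta>\<^sup>2))"
    using sqrt_delta by (intro arccos_minus) linarith+
  then show ?thesis
    using slit_prim_0 by (simp add: slit_prim_def)
qed

text \<open>The upper bound compares the two end values of the increasing
  \<open>slit_prim \<delta>\<close>, namely a and 2 pi - a.\<close>

lemma slit_a_bounds: "0 < slit_a \<delta>" "slit_a \<delta> < pi"
proof -
  show "0 < slit_a \<delta>"
    using \<delta> sqrt_delta(1) by (simp add: slit_a_def zero_less_arctan_iff)
  have "slit_prim \<delta> 0 < slit_prim \<delta> (2 * pi)"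
    by (intro slit_prim_strict_mono) auto
  then show "slit_a \<delta> < pi"
    unfolding slit_prim_0 slit_prim_2pi by simp
qed

lemma slit_q_bounds: "0 < slit_q \<delta>" "slit_q \<delta> < 1"
  using slit_a_bounds by (simp_all add: slit_q_def)

lemma slit_prim_continuous: "continuous_on {0..2 * pi} (slit_prim \<delta>)"
  by (rule has_real_derivative_imp_continuous_on[OF slit_prim_has_derivative]) auto

lemma slit_prim_range:
  assumes "0 \<le> s" "s \<le> 2 * pi"
  shows "slit_prim \<delta> s \<in> {slit_a \<delta>..2 * pi - slit_a \<delta>}"
proof -
  have "slit_prim \<delta> 0 \<le> slit_prim \<delta> s"
    using slit_prim_strict_mono[of 0 s] assms by (cases "s = 0") auto
  moreover have "slit_prim \<delta> s \<le> slit_prim \<delta> (2 * pi)"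
    using slit_prim_strict_mono[of s "2 * pi"] assms by (cases "s = 2 * pi") auto
  ultimately show ?thesis
    unfolding slit_prim_0 slit_prim_2pi by simp
qed

lemma integral_slit_dens:
  assumes "0 \<le> s" "s \<le> 2 * pi"
  shows "integral {0..s} (slit_dens \<delta>) = slit_prim \<delta> s - slit_a \<delta>"
proof -
  have "(slit_prim \<delta> has_vector_derivative slit_dens \<delta> r) (at r within {0..s})" if "r \<in> {0..s}" for r
    using has_field_derivative_at_within[OF slit_prim_has_derivative] that assms
    by (simp flip: has_real_derivative_iff_has_vector_derivative)
  then have "(slit_dens \<delta> has_integral (slit_prim \<delta> s - slit_prim \<delta> 0)) {0..s}"
    using assms by (intro fundamental_theorem_of_calculus)
  then show ?thesis
    by (simp add: integral_unique slit_prim_0)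
qed

lemma slit_inv_mod2pi:
  assumes "0 \<le> s" "s < 2 * pi"
  shows "slit_inv \<delta> x (x + mod2pi s) = x + mod2pi (slit_prim \<delta> s)"
  using assms by (simp add: slit_inv_def angle_mod2pi slit_D_mod2pi integral_slit_dens)

subsection \<open>The one-step kernel\<close>

lemmas slit_facts = slit_D_minus slit_D_nonneg
  slit_D_le_1 slit_D_mod2pi slit_a_bounds slit_q_bounds

lemma measurable_D_diff [measurable]: "(\<lambda>y. slit_D \<delta> (x - y)) \<in> borel_measurable borel"
proof -
  have "(\<lambda>y. slit_D \<delta> (- x + y)) \<in> borel_measurable borel" by measurable
  moreover have "slit_D \<delta> (- x + y) = slit_D \<delta> (x - y)" for y
    using slit_D_minus[of "x - y"] by (simp add: algebra_simps)
  ultimately show ?thesis by simp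
qed

lemma integral_slit_D: "(LINT x|circle_measure. slit_D \<delta> x) = 2 * pi - 2 * slit_a \<delta>"
proof -
  have "set_integrable lborel {0..2 * pi} (slit_dens \<delta>)"
    by (intro borel_integrable_atLeastAtMost' continuous_on_slit_dens)
  from set_borel_integral_eq_integral(2)[OF this]
  have "(LINT s|lborel. slit_dens \<delta> s * indicator {0..2 * pi} s) = integral {0..2 * pi} (slit_dens \<delta>)"
    by (simp add: set_lebesgue_integral_def mult.commute)
  then show ?thesis
    by (simp add: integral_circle_measure_Icc slit_facts integral_slit_dens slit_prim_2pi)
qed

lemma integral_slit_D_diff: "(LINT x|circle_measure. slit_D \<delta> (x - y)) = 2 * pi - 2 * slit_a \<delta>"
  using integral_circle_add[OF borel_measurable_slit_D, of "- y"] by (simp add: integral_slit_D)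

lemma slit_D_commute: "slit_D \<delta> (x - y) = slit_D \<delta> (y - x)"
  using slit_D_minus[of "x - y"] by simp

lemma slit_F_eq_circle_conv:
  assumes A: "closed A"
  shows "slit_F \<delta> A x = circle_conv (slit_D \<delta>) (indicator A) x"
proof -
  have [measurable]: "A \<in> sets borel" using A by simp
  \<comment> \<open>\<open>A\<close> in the coordinate measured from \<open>x\<close>. If
    \<open>x\<close> lies in \<open>A\<close>, both 0 and \<open>2 * pi\<close> belong to
    \<open>A'\<close>, and they are sent to the two tips of the removed arc.\<close>
  define A' where "A' = {s \<in> {0..2 * pi}. x + mod2pi s \<in> A}"
  define K where "K = slit_prim \<delta> ` A'"
  define E where "E = (+) x ` mod2pi ` K"
  define I where "I = slit_inv \<delta> x ` (A - {x})"
  define a where "a = slit_a \<delta>"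
  have a: "0 < a" by (simp add: a_def slit_facts)
  have "closed (mod2pi -` ((+) x -` A))"
    using A continuous_on_circle_add[of x] continuous_on_mod2pi
    by (intro closed_vimage) auto
  moreover have "A' = {0..2 * pi} \<inter> mod2pi -` ((+) x -` A)"
    by (auto simp: A'_def)
  ultimately have "compact A'"
    by (simp add: compact_Int_closed)
  then have K: "compact K"
    unfolding K_def A'_def
    by (intro compact_continuous_image continuous_on_subset[OF slit_prim_continuous]) auto
  \<comment> \<open>Since \<open>a > 0\<close>, \<open>K\<close> stays strictly inside one period,
    so \<open>mod2pi\<close> is injective on it and arc length there is plain Lebesgue
    measure.\<close>
  have K_sub: "K \<subseteq> {a..2 * pi - a}"
    unfolding K_def A'_def a_def using slit_prim_range by auto
  have E: "closed E"
    unfolding E_def by (intro closed_circle_add closed_mod2pi_image K)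

  have "I \<subseteq> E"
  proof
    fix z assume "z \<in> I"
    then obtain y where y: "y \<in> A" "z = slit_inv \<delta> x y"
      by (auto simp: I_def)
    obtain s where s: "0 \<le> s" "s < 2 * pi" "y - x = mod2pi s"
      by (rule circle_cases)
    then have "y = x + mod2pi s" by (simp add: algebra_simps flip: s(3))
    then show "z \<in> E"
      using y s by (auto simp: slit_inv_mod2pi E_def K_def A'_def)
  qed
  then have "closure I \<subseteq> E"
    using E by (rule closure_minimal)
  \<comment> \<open>The closure adds at most the two tips of the removed arc, which form a null set.\<close>
  have "E \<subseteq> insert (x + mod2pi a) (insert (x + mod2pi (2 * pi - a)) I)"
  proof
    fix z assume "z \<in> E"
    then obtain s where s: "0 \<le> s" "s \<le> 2 * pi" "x + mod2pi s \<in> A"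
      and z: "z = x + mod2pi (slit_prim \<delta> s)"
      by (auto simp: E_def K_def A'_def)
    consider "s = 0" | "s = 2 * pi" | "0 < s" "s < 2 * pi" using s by linarith
    then show "z \<in> insert (x + mod2pi a) (insert (x + mod2pi (2 * pi - a)) I)"
    proof cases
      case 3
      have "mod2pi s \<noteq> 0"
        using mod2pi_eq_imp_eq[of s 0] 3 by (auto simp: zero_circle_def)
      then have "x + mod2pi s \<in> A - {x}"
        using s by simp
      moreover have "z = slit_inv \<delta> x (x + mod2pi s)"
        using z 3 by (simp add: slit_inv_mod2pi)
      ultimately show ?thesis
        unfolding I_def by blast
    qed (simp_all add: z a_def slit_prim_0 slit_prim_2pi)
  qed
  then have E_sub: "E \<subseteq> insert (x + mod2pi a) (insert (x + mod2pi (2 * pi - a)) (closure I))"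
    using closure_subset[of I] by blast
  have "len E \<le> len (insert (x + mod2pi a) (insert (x + mod2pi (2 * pi - a)) (closure I)))"
    unfolding len_def by (intro circle.finite_measure_mono E_sub) (simp add: closed_circle_insert)
  moreover have "len (closure I) \<le> len E"
    unfolding len_def using E by (intro circle.finite_measure_mono \<open>closure I \<subseteq> E\<close>) auto
  ultimately have "len (closure I) = len E"
    by (simp add: len_insert closed_circle_insert)
  also have "len E = len (mod2pi ` K)"
    unfolding E_def using E by (intro len_circle_add) (simp add: E_def)
  also have "\<dots> = measure lborel (mod2pi -` (mod2pi ` K) \<inter> {0..<2 * pi})"
    using closed_mod2pi_image[OF K] by (simp add: len_eq_measure_lborel)
  also have "mod2pi -` (mod2pi ` K) \<inter> {0..<2 * pi} = K"
  proof
    show "mod2pi -` (mod2pi ` K) \<inter> {0..<2 * pi} \<subseteq> K"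
    proof
      fix s assume "s \<in> mod2pi -` (mod2pi ` K) \<inter> {0..<2 * pi}"
      then obtain r where "r \<in> K" "mod2pi s = mod2pi r" "0 \<le> s" "s < 2 * pi"
        by auto
      moreover have "0 \<le> r" "r < 2 * pi"
        using \<open>r \<in> K\<close> K_sub a by auto
      ultimately show "s \<in> K"
        using mod2pi_eq_imp_eq[of s r] by simp
    qed
  qed (use K_sub a in auto)
  \<comment> \<open>The second indicator, of the range of \<open>slit_prim \<delta>\<close>, gives
    the integral the shape of the substitution rule.\<close>
  also have "measure lborel K = (LINT r|lborel. indicator K r * indicator {slit_prim \<delta> 0..slit_prim \<delta> (2 * pi)} r)"
  proof -
    have "indicator K r * indicator {slit_prim \<delta> 0..slit_prim \<delta> (2 * pi)} r = (indicator K r :: real)" for r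
      using K_sub by (auto simp: slit_prim_0 slit_prim_2pi a_def split: split_indicator)
    then show ?thesis
      by (subst Bochner_Integration.integral_cong[OF refl]) (assumption, simp)
  qed
  also have "\<dots> = (LINT s|lborel. indicator K (slit_prim \<delta> s) * slit_dens \<delta> s * indicator {0..2 * pi} s)"
  proof (rule integral_substitution(2))
    have "integrable lborel (indicator K :: real \<Rightarrow> real)"
      using K by (intro integrable_real_indicator emeasure_compact_finite) (auto intro: borel_closed compact_imp_closed)
    then show "set_integrable lborel {slit_prim \<delta> 0..slit_prim \<delta> (2 * pi)} (indicator K :: real \<Rightarrow> real)"
      unfolding set_integrable_def by (intro integrable_mult_indicator) auto
  qed (use slit_prim_has_derivative slit_dens_nonneg continuous_on_slit_dens in auto)
  also have "\<dots> = (LINT s|lborel. (indicator A (x + mod2pi s) * slit_D \<delta> (mod2pi s)) * indicator {0..2 * pi} s)"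
  proof (rule Bochner_Integration.integral_cong[OF refl])
    fix s
    have "slit_prim \<delta> s \<in> K \<longleftrightarrow> x + mod2pi s \<in> A" if "s \<in> {0..2 * pi}"
    proof -
      have "A' \<subseteq> {0..2 * pi}" by (auto simp: A'_def)
      from inj_on_image_mem_iff[OF inj_on_slit_prim that this] show ?thesis
        using that by (simp add: K_def A'_def)
    qed
    then show "indicator K (slit_prim \<delta> s) * slit_dens \<delta> s * indicator {0..2 * pi} s =
        indicator A (x + mod2pi s) * slit_D \<delta> (mod2pi s) * indicator {0..2 * pi} s"
      by (auto simp: slit_facts split: split_indicator)
  qed
  also have "\<dots> = (LINT u|circle_measure. indicator A (x + u) * slit_D \<delta> u)"
    by (rule integral_circle_measure_Icc[symmetric]) measurable
  \<comment> \<open>D is even and \<open>- u = x - (x + u)\<close>; the rotation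
    \<open>y = x + u\<close> then yields the convolution.\<close>
  also have "\<dots> = (LINT u|circle_measure. slit_D \<delta> (x - (x + u)) * indicator A (x + u))"
    by (simp add: slit_facts mult.commute)
  also have "\<dots> = (LINT y|circle_measure. slit_D \<delta> (x - y) * indicator A y)"
    by (rule integral_circle_add[of "\<lambda>y. slit_D \<delta> (x - y) * indicator A y"]) measurable
  finally show ?thesis
    by (simp add: slit_F_def slit_update_def I_def circle_conv_def)
qed

section \<open>Continuity, mean and range of the convolution\<close>

lemma integrable_slit_D_diff: "A \<in> sets borel \<Longrightarrow> integrable circle_measure (\<lambda>y. slit_D \<delta> (x - y) * indicator A y)"
  by (rule circle.integrable_const_bound[where B = 1])
    (auto simp: slit_facts abs_mult split: split_indicator)

text \<open>Dominated convergence along sequences of real lifts: D is continuous and the integrand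
  is bounded by 1. The result supplies measurability as well as the passage from zero variance to a
  pointwise identity.\<close>

lemma continuous_on_circle_conv:
  assumes [measurable]: "A \<in> sets borel"
  shows "continuous_on UNIV (circle_conv (slit_D \<delta>) (indicator A))"
proof (rule continuous_on_circleI, rule continuous_at_imp_continuous_on, intro ballI continuous_at_sequentiallyI)
  fix t :: real and u assume u: "u \<longlonglongrightarrow> t"
  have "(\<lambda>n. slit_D \<delta> (mod2pi (u n) - y)) \<longlonglongrightarrow> slit_D \<delta> (mod2pi t - y)" for y
  proof -
    have "(\<lambda>n. slit_dens \<delta> (u n - angle y)) \<longlonglongrightarrow> slit_dens \<delta> (t - angle y)"
      by (rule continuous_on_tendsto_compose[OF continuous_on_slit_dens[of UNIV]])
        (use u in \<open>auto intro!: tendsto_intros\<close>)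
    then show ?thesis
      by (simp add: mod2pi_diff flip: slit_D_mod2pi)
  qed
  then show "(\<lambda>n. circle_conv (slit_D \<delta>) (indicator A) (mod2pi (u n)))
      \<longlonglongrightarrow> circle_conv (slit_D \<delta>) (indicator A) (mod2pi t)"
    unfolding circle_conv_def
    by (intro integral_dominated_convergence[where w = "\<lambda>_. 1"])
      (auto intro!: tendsto_intros simp: slit_facts abs_mult split: split_indicator)
qed

text \<open>After exchanging the integrals, the inner one is the integral of a rotated copy of D,
  hence independent of the other variable.\<close>

lemma integral_circle_conv:
  assumes [measurable]: "A \<in> sets borel"
  shows "(LINT x|circle_measure. circle_conv (slit_D \<delta>) (indicator A) x) = (2 * pi - 2 * slit_a \<delta>) * len A"
proof -
  \<comment> \<open>Fubini is carried out on the fundamental interval, where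
    \<open>slit_dens \<delta> (t - s)\<close> is jointly measurable as a continuous function of a
    difference of reals.\<close>
  define M where "M = restrict_space lborel {0..<2 * pi}"
  interpret M: finite_measure M
    by standard (simp add: M_def emeasure_restrict_space space_restrict_space)
  interpret P: pair_sigma_finite M M ..
  interpret PM: finite_measure "M \<Otimes>\<^sub>M M"
    by (rule finite_measure_pair_measure) unfold_locales
  have [measurable]: "mod2pi \<in> measurable M borel"
    unfolding M_def by (rule measurable_mod2pi)
  have id_M: "(\<lambda>s. s) \<in> borel_measurable M"
    unfolding M_def by (intro measurable_restrict_space1) simp
  have [measurable]: "(\<lambda>p. slit_dens \<delta> (snd p - fst p)) \<in> borel_measurable (M \<Otimes>\<^sub>M M)"
    by (rule measurable_compose[OF _ borel_measurable_slit_dens])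
      (intro borel_measurable_diff measurable_compose[OF measurable_fst id_M] measurable_compose[OF measurable_snd id_M])
  have conv: "circle_conv (slit_D \<delta>) (indicator A) (mod2pi t) =
      (LINT s|M. slit_dens \<delta> (t - s) * indicator A (mod2pi s))" for t
    unfolding circle_conv_def M_def
    by (subst integral_circle_measure) (auto simp: slit_facts simp flip: mod2pi_diff)
  have "(LINT x|circle_measure. circle_conv (slit_D \<delta>) (indicator A) x) =
      (LINT t|M. LINT s|M. slit_dens \<delta> (t - s) * indicator A (mod2pi s))"
    unfolding conv[symmetric] unfolding M_def
    by (intro integral_circle_measure borel_measurable_continuous_onI continuous_on_circle_conv assms)
  also have "\<dots> = (LINT s|M. LINT t|M. slit_dens \<delta> (t - s) * indicator A (mod2pi s))"
  proof (rule P.Fubini_integral)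
    show "integrable (M \<Otimes>\<^sub>M M) (\<lambda>(s, t). slit_dens \<delta> (t - s) * indicator A (mod2pi s))"
      unfolding split_beta'
      by (rule PM.integrable_const_bound[where B = 1])
        (auto simp: abs_mult slit_dens_nonneg slit_dens_le_1 split: split_indicator)
  qed
  also have "\<dots> = (LINT s|M. (LINT t|M. slit_dens \<delta> (t - s)) * indicator A (mod2pi s))"
    by simp
  also have "\<dots> = (LINT s|M. (2 * pi - 2 * slit_a \<delta>) * indicator A (mod2pi s))"
  proof -
    have "(LINT t|M. slit_dens \<delta> (t - s)) = (LINT x|circle_measure. slit_D \<delta> (x - mod2pi s))" for s
    proof -
      have "(\<lambda>x. slit_D \<delta> (x - mod2pi s)) \<in> borel_measurable borel"
        by (subst slit_D_commute) measurable
      from integral_circle_measure[OF this] show ?thesis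
        by (simp add: M_def slit_facts flip: mod2pi_diff)
    qed
    then show ?thesis by (simp add: integral_slit_D_diff)
  qed
  also have "\<dots> = (LINT y|circle_measure. (2 * pi - 2 * slit_a \<delta>) * indicator A y)"
    unfolding M_def by (rule integral_circle_measure[symmetric]) measurable
  also have "\<dots> = (2 * pi - 2 * slit_a \<delta>) * len A"
    by (simp add: len_def)
  finally show ?thesis .
qed

text \<open>Both parts rest on D having values between 0 and 1. For the second, enlarging
  \<open>A\<close> to the whole circle can only increase the integral of 1 - D over it, whose value
  is then 2 pi - (2 pi - 2 a) = 2 a.\<close>

lemma circle_conv_bounds:
  assumes [measurable]: "A \<in> sets borel"
  shows "circle_conv (slit_D \<delta>) (indicator A) x \<le> len A"
    and "len A - circle_conv (slit_D \<delta>) (indicator A) x \<le> 2 * slit_a \<delta>"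
proof -
  have iA: "integrable circle_measure (indicator A :: circle \<Rightarrow> real)"
    by (simp add: circle.emeasure_finite less_top[symmetric])
  have len: "len A = (LINT y|circle_measure. indicator A y)"
    by (simp add: len_def)
  show "circle_conv (slit_D \<delta>) (indicator A) x \<le> len A"
    unfolding circle_conv_def len
    by (intro integral_mono integrable_slit_D_diff iA assms) (auto simp: slit_facts split: split_indicator)
  have iD: "integrable circle_measure (\<lambda>y. 1 - slit_D \<delta> (x - y))"
    using integrable_slit_D_diff[of UNIV x] by auto
  have "len A - circle_conv (slit_D \<delta>) (indicator A) x =
      (LINT y|circle_measure. indicator A y - slit_D \<delta> (x - y) * indicator A y)"
    unfolding circle_conv_def len
    by (rule Bochner_Integration.integral_diff[symmetric]) (intro integrable_slit_D_diff iA assms)+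
  also have "\<dots> \<le> (LINT y|circle_measure. 1 - slit_D \<delta> (x - y))"
    by (intro integral_mono Bochner_Integration.integrable_diff integrable_slit_D_diff iA iD assms)
      (auto simp: slit_facts split: split_indicator)
  also have "\<dots> = 2 * pi - (LINT y|circle_measure. slit_D \<delta> (x - y))"
    using integrable_slit_D_diff[of UNIV x] by (simp add: measure_circle_UNIV)
  also have "\<dots> = 2 * pi - (LINT y|circle_measure. slit_D \<delta> (y - x))"
    by (subst slit_D_commute) (rule refl)
  finally show "len A - circle_conv (slit_D \<delta>) (indicator A) x \<le> 2 * slit_a \<delta>"
    by (simp add: integral_slit_D_diff)
qed

lemma slit_H_moments:
  fixes A :: "circle set"
  assumes A: "closed A"
  defines "F \<equiv> circle_conv (slit_D \<delta>) (indicator A)"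
  defines "m \<equiv> slit_q \<delta> * len A"
  shows "2 * pi * (slit_H \<delta> A - (slit_q \<delta>)\<^sup>2 * (len A)\<^sup>2) = (LINT x|circle_measure. (F x - m)\<^sup>2)"
    and "2 * pi * (slit_H \<delta> A - (slit_q \<delta>)\<^sup>2 * (len A)\<^sup>2) =
      (LINT x|circle_measure. (len A - F x)\<^sup>2) - 2 * pi * (len A - m)\<^sup>2"
    and "(LINT x|circle_measure. len A - F x) = 2 * slit_a \<delta> * len A"
    and "integrable circle_measure F" and "integrable circle_measure (\<lambda>x. (F x)\<^sup>2)"
proof -
  have Ab: "A \<in> sets borel" using A by simp
  have [measurable]: "F \<in> borel_measurable borel"
    unfolding F_def by (intro borel_measurable_continuous_onI continuous_on_circle_conv Ab)
  have F: "\<bar>F x\<bar> \<le> len A" for x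
  proof -
    have "0 \<le> F x"
      unfolding F_def circle_conv_def by (rule Bochner_Integration.integral_nonneg) (simp add: slit_D_nonneg)
    then show ?thesis
      using circle_conv_bounds(1)[OF Ab, of x] by (simp add: F_def)
  qed
  show iF: "integrable circle_measure F"
    by (rule circle.integrable_const_bound[where B = "len A"]) (simp_all add: F)
  show iF2: "integrable circle_measure (\<lambda>x. (F x)\<^sup>2)"
  proof (rule circle.integrable_const_bound[where B = "(len A)\<^sup>2"])
    have "(F x)\<^sup>2 \<le> (len A)\<^sup>2" for x
      using power_mono[OF F abs_ge_zero, of x 2] by (simp only: power2_abs)
    then show "AE x in circle_measure. norm ((F x)\<^sup>2) \<le> (len A)\<^sup>2"
      by simp
  qed measurable
  have mean: "(LINT x|circle_measure. F x) = 2 * pi * m"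
    using integral_circle_conv[OF Ab]
    by (simp add: F_def m_def slit_q_def algebra_simps)
  show "(LINT x|circle_measure. len A - F x) = 2 * slit_a \<delta> * len A"
    using iF by (simp add: mean measure_circle_UNIV m_def slit_q_def algebra_simps)
  have H: "2 * pi * slit_H \<delta> A = (LINT x|circle_measure. (F x)\<^sup>2)"
    by (simp add: slit_H_def F_def slit_F_eq_circle_conv[OF A])
  \<comment> \<open>One expansion serves both identities: \<open>c = m\<close>, the mean of
    \<open>F\<close>, gives the variance, and \<open>c = len A\<close> gives the second moment of
    \<open>len A - F\<close>.\<close>
  have sq: "(LINT x|circle_measure. (F x - c)\<^sup>2) = 2 * pi * slit_H \<delta> A - 2 * c * (2 * pi * m) + 2 * pi * c\<^sup>2" for c
  proof -
    have "(LINT x|circle_measure. (F x - c)\<^sup>2) = (LINT x|circle_measure. (F x)\<^sup>2 - 2 * c * F x + c\<^sup>2)"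
      by (intro Bochner_Integration.integral_cong) (simp_all add: power2_diff)
    also have "\<dots> = 2 * pi * slit_H \<delta> A - 2 * c * (2 * pi * m) + 2 * pi * c\<^sup>2"
      using iF iF2 by (simp add: mean H[symmetric] measure_circle_UNIV)
    finally show ?thesis .
  qed
  show "2 * pi * (slit_H \<delta> A - (slit_q \<delta>)\<^sup>2 * (len A)\<^sup>2) = (LINT x|circle_measure. (F x - m)\<^sup>2)"
    unfolding sq by (simp add: m_def power2_eq_square algebra_simps)
  show "2 * pi * (slit_H \<delta> A - (slit_q \<delta>)\<^sup>2 * (len A)\<^sup>2) =
      (LINT x|circle_measure. (len A - F x)\<^sup>2) - 2 * pi * (len A - m)\<^sup>2"
    unfolding power2_commute[of "len A" "F _"] sq by (simp add: m_def power2_eq_square algebra_simps)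
qed

section \<open>The two bounds, the equality case and short arcs\<close>

lemma slit_H_lower:
  assumes "closed A"
  shows "0 \<le> slit_H \<delta> A - (slit_q \<delta>)\<^sup>2 * (len A)\<^sup>2"
proof -
  have "0 \<le> 2 * pi * (slit_H \<delta> A - (slit_q \<delta>)\<^sup>2 * (len A)\<^sup>2)"
    unfolding slit_H_moments(1)[OF assms] by (rule Bochner_Integration.integral_nonneg) simp
  then show ?thesis
    using pi_gt_zero by (auto simp: zero_le_mult_iff dest: less_le_not_le[THEN iffD1])
qed

text \<open>Put G = |A| - F. The variance is at most the second moment, and G between 0 and 2 a
  gives G * G \<le> 2 a G pointwise. As G has integral 2 a |A|, division by 2 pi leaves 4 a * a |A|
  / (2 pi), which is the stated constant.\<close>

lemma slit_H_upper:
  assumes A: "closed A"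
  shows "slit_H \<delta> A - (slit_q \<delta>)\<^sup>2 * (len A)\<^sup>2 \<le> 2 * (slit_a \<delta>)\<^sup>2 / pi * len A"
proof -
  define F where "F = circle_conv (slit_D \<delta>) (indicator A)"
  note moments = slit_H_moments[OF A, folded F_def]
  have Ab: "A \<in> sets borel" using A by simp
  have F: "0 \<le> len A - F x" "len A - F x \<le> 2 * slit_a \<delta>" for x
    using circle_conv_bounds[OF Ab, of x] by (simp_all add: F_def)
  have "2 * pi * (slit_H \<delta> A - (slit_q \<delta>)\<^sup>2 * (len A)\<^sup>2) \<le> (LINT x|circle_measure. (len A - F x)\<^sup>2)"
    unfolding moments(2) by simp
  also have "\<dots> \<le> (LINT x|circle_measure. 2 * slit_a \<delta> * (len A - F x))"
  proof (rule integral_mono)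
    show "integrable circle_measure (\<lambda>x. (len A - F x)\<^sup>2)"
      unfolding power2_diff using moments(4,5) by auto
    show "integrable circle_measure (\<lambda>x. 2 * slit_a \<delta> * (len A - F x))"
      using moments(4) by auto
    show "(len A - F x)\<^sup>2 \<le> 2 * slit_a \<delta> * (len A - F x)" for x
      unfolding power2_eq_square using F[of x] by (intro mult_right_mono)
  qed
  also have "\<dots> = 2 * slit_a \<delta> * (2 * slit_a \<delta> * len A)"
    using moments(3) by simp
  finally show ?thesis
    by (simp add: field_simps power2_eq_square)
qed

text \<open>A continuous nonnegative function with zero integral vanishes at every point, not merely
  almost everywhere. The short-arc argument relies on this, because it evaluates the convolution at
  one chosen point.\<close>

lemma circle_conv_eq_mean:
  assumes A: "closed A" and eq: "slit_H \<delta> A - (slit_q \<delta>)\<^sup>2 * (len A)\<^sup>2 = 0"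
  shows "circle_conv (slit_D \<delta>) (indicator A) x = slit_q \<delta> * len A"
proof -
  define g where "g = (\<lambda>x. (circle_conv (slit_D \<delta>) (indicator A) x - slit_q \<delta> * len A)\<^sup>2)"
  have "A \<in> sets borel" using A by simp
  from continuous_on_circle_conv[OF this] have contg: "continuous_on UNIV g"
    unfolding g_def by (intro continuous_intros)
  then have g [measurable]: "g \<in> borel_measurable borel"
    by (rule borel_measurable_continuous_onI)
  have cont: "continuous_on S (\<lambda>s. g (mod2pi s))" for S
    by (rule continuous_on_compose2[OF contg continuous_on_subset[OF continuous_on_mod2pi]]) auto
  have "set_integrable lborel {0..2 * pi} (\<lambda>s. g (mod2pi s))"
    by (intro borel_integrable_atLeastAtMost' cont)
  from set_borel_integral_eq_integral(2)[OF this]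
  have "integral {0..2 * pi} (\<lambda>s. g (mod2pi s)) = (LINT x|circle_measure. g x)"
    by (simp add: set_lebesgue_integral_def integral_circle_measure_Icc mult.commute)
  also have "\<dots> = 0"
    using slit_H_moments(1)[OF A] eq by (simp add: g_def)
  finally have "integral {0..2 * pi} (\<lambda>s. g (mod2pi s)) = 0" .
  moreover have "0 \<le> g y" for y
    by (simp add: g_def)
  ultimately have "\<forall>s\<in>{0..2 * pi}. g (mod2pi s) = 0"
    using integral_eq_0_iff[OF cont, of 0 "2 * pi"] by simp
  moreover have "angle x \<in> {0..2 * pi}"
    using angle_nonneg[of x] angle_less[of x] by simp
  ultimately have "g (mod2pi (angle x)) = 0" by blast
  then show ?thesis by (simp add: g_def)
qed

text \<open>Equality would force the convolution to equal q |A| everywhere, whereas at an endpoint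
  of a short arc it is at most q |A| / 2. The clause \<open>L0 < 2 * pi\<close> guarantees that arcs
  of length below \<open>L0\<close> can be written down as witnesses.\<close>

lemma slit_H_short_arc:
  "\<exists>L0>0. L0 < 2 * pi \<and> (\<forall>A. is_arc A \<longrightarrow> 0 < len A \<longrightarrow> len A < L0 \<longrightarrow>
    slit_H \<delta> A > (slit_q \<delta>)\<^sup>2 * (len A)\<^sup>2)"
proof -
  note q = slit_q_bounds
  have "slit_dens \<delta> 0 = 0" by (simp add: slit_dens_def)
  moreover have "isCont (slit_dens \<delta>) 0"
    using continuous_on_slit_dens[of UNIV] by (simp add: continuous_on_eq_continuous_at)
  ultimately have "((slit_dens \<delta>) \<longlongrightarrow> 0) (at 0)"
    by (simp add: isCont_def)
  then obtain d where "d > 0" "\<And>s. s \<noteq> 0 \<Longrightarrow> \<bar>s\<bar> < d \<Longrightarrow> \<bar>slit_dens \<delta> s\<bar> < slit_q \<delta> / 2"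
    using LIM_D[of "slit_dens \<delta>" 0 0 "slit_q \<delta> / 2"] q(1) by auto
  \<comment> \<open>The limit says nothing about \<open>s = 0\<close>; there the density is
    0.\<close>
  then have d: "d > 0" "\<And>s. \<bar>s\<bar> < d \<Longrightarrow> \<bar>slit_dens \<delta> s\<bar> < slit_q \<delta> / 2"
    using \<open>slit_dens \<delta> 0 = 0\<close> q(1) by (simp, metis abs_zero half_gt_zero)
  \<comment> \<open>In the threshold, \<open>d\<close> keeps the arc where D is small and 1 keeps it
    below \<open>2 * pi\<close>.\<close>
  have "slit_H \<delta> A > (slit_q \<delta>)\<^sup>2 * (len A)\<^sup>2"
    if A: "is_arc A" "0 < len A" "len A < min d 1" for A
  proof (rule ccontr)
    have clA: "closed A" using A(1) by (rule closed_arc)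
    then have Ab [measurable]: "A \<in> sets borel" by simp
    obtain a b where ab: "a \<le> b" "b \<le> a + 2 * pi" "A = mod2pi ` {a..b}"
      using A(1) by (auto simp: is_arc_def)
    assume "\<not> ?thesis"
    then have "slit_H \<delta> A - (slit_q \<delta>)\<^sup>2 * (len A)\<^sup>2 = 0"
      using slit_H_lower[OF clA] by simp
    \<comment> \<open>Seen from the endpoint \<open>a\<close>, every point of the arc lies within
      distance \<open>len A < d\<close>.\<close>
    then have "slit_q \<delta> * len A = circle_conv (slit_D \<delta>) (indicator A) (mod2pi a)"
      by (rule circle_conv_eq_mean[OF clA, symmetric])
    also have "\<dots> \<le> (LINT y|circle_measure. slit_q \<delta> / 2 * indicator A y)"
      unfolding circle_conv_def
    proof (rule integral_mono)
      show "integrable circle_measure (\<lambda>y. slit_D \<delta> (mod2pi a - y) * indicator A y)"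
        by (rule integrable_slit_D_diff[OF Ab])
      show "integrable circle_measure (\<lambda>y. slit_q \<delta> / 2 * indicator A y)"
        by (simp add: circle.emeasure_finite less_top[symmetric])
      fix y
      have "slit_D \<delta> (mod2pi a - y) \<le> slit_q \<delta> / 2" if y: "y \<in> A"
      proof -
        obtain s where s: "a \<le> s" "s \<le> b" "y = mod2pi s"
          using y unfolding ab(3) by auto
        have "\<bar>a - s\<bar> < d"
          using s A(3) ab len_mod2pi_Icc[OF ab(1,2)] by simp
        from d(2)[OF this] show ?thesis
          by (simp add: s slit_D_mod2pi flip: mod2pi_diff)
      qed
      then show "slit_D \<delta> (mod2pi a - y) * indicator A y \<le> slit_q \<delta> / 2 * indicator A y"
        by (simp split: split_indicator)
    qed
    also have "\<dots> = slit_q \<delta> / 2 * len A"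
      by (simp add: len_def)
    finally show False
      using q A(2) by simp
  qed
  then show ?thesis
    using d(1) pi_gt3 by (intro exI[of _ "min d 1"]) auto
qed

end

theorem lemma3p2:
  fixes N :: nat and l \<delta> :: real
  assumes "N \<ge> 1" and "l > 0" and "\<delta> = slit_delta N l"
  shows "(\<forall>A. disjoint_arc_union A \<longrightarrow>
           0 \<le> slit_H \<delta> A - (slit_q \<delta>)\<^sup>2 * (len A)\<^sup>2 \<and>
           slit_H \<delta> A - (slit_q \<delta>)\<^sup>2 * (len A)\<^sup>2 \<le> 2 * (slit_a \<delta>)\<^sup>2 / pi * len A)
       \<and> (\<forall>A. disjoint_arc_union A \<longrightarrow>
           slit_H \<delta> A - (slit_q \<delta>)\<^sup>2 * (len A)\<^sup>2 = 0 \<longrightarrow>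
           (\<exists>c. \<forall>x. circle_conv (slit_D \<delta>) (indicator A) x = c))
       \<and> (\<exists>A. disjoint_arc_union A \<and> \<not> slit_H \<delta> A \<le> (slit_q \<delta>)\<^sup>2 * (len A)\<^sup>2)
       \<and> (\<exists>L0>0. \<forall>A. is_arc A \<longrightarrow> 0 < len A \<longrightarrow> len A < L0 \<longrightarrow>
           slit_H \<delta> A > (slit_q \<delta>)\<^sup>2 * (len A)\<^sup>2)"
proof -
  have \<delta>: "0 < \<delta>" "\<delta> < 1"
    using slit_delta_bounds[OF assms(1,2)] assms(3) by simp_all
  obtain L0 where L0: "L0 > 0" "L0 < 2 * pi" "\<And>A. is_arc A \<Longrightarrow> 0 < len A \<Longrightarrow> len A < L0 \<Longrightarrow>
      slit_H \<delta> A > (slit_q \<delta>)\<^sup>2 * (len A)\<^sup>2"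
    using slit_H_short_arc[OF \<delta>] by blast
  \<comment> \<open>A short arc itself witnesses the failure of the contraction; its length
    \<open>L0 / 2\<close> lies strictly between 0 and \<open>L0\<close>.\<close>
  define J where "J = mod2pi ` {0..L0 / 2}"
  have J: "is_arc J"
    unfolding is_arc_def J_def using L0 by (intro exI[of _ 0] exI[of _ "L0 / 2"]) auto
  then have "disjoint_arc_union J"
    unfolding disjoint_arc_union_def by (intro exI[of _ "{J}"]) simp
  moreover have "len J = L0 / 2"
    using L0 len_mod2pi_Icc[of 0 "L0 / 2"] by (simp add: J_def)
  then have "slit_H \<delta> J > (slit_q \<delta>)\<^sup>2 * (len J)\<^sup>2"
    using L0 J by simp
  ultimately have "\<exists>A. disjoint_arc_union A \<and> \<not> slit_H \<delta> A \<le> (slit_q \<delta>)\<^sup>2 * (len A)\<^sup>2"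
    by (intro exI[of _ J]) simp
  moreover have "\<exists>c. \<forall>x. circle_conv (slit_D \<delta>) (indicator A) x = c"
    if "disjoint_arc_union A" "slit_H \<delta> A - (slit_q \<delta>)\<^sup>2 * (len A)\<^sup>2 = 0" for A
    using circle_conv_eq_mean[OF \<delta> closed_disjoint_arc_union[OF that(1)] that(2)] by blast
  moreover have "\<exists>L0>0. \<forall>A. is_arc A \<longrightarrow> 0 < len A \<longrightarrow> len A < L0 \<longrightarrow>
      slit_H \<delta> A > (slit_q \<delta>)\<^sup>2 * (len A)\<^sup>2"
    using L0(1,3) by (intro exI[of _ L0]) simp
  ultimately show ?thesis
    using slit_H_lower[OF \<delta> closed_disjoint_arc_union]
      slit_H_upper[OF \<delta> closed_disjoint_arc_union] by (intro conjI allI impI) simp_all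
qed

end
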